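(* Let $f:\mathbb H^+\to\mathbb H^+$ be a slice regular function with a fixed point $q_0\in\mathbb H^+$. Then $f'(\infty)\leq1$, with equality if and only if $f(q)=q$ for all $q\in\mathbb H^+$.
   Context: $\mathbb H$ is the algebra of quaternions, $\mathbb H^+=\{q\in\mathbb H:\mathrm{Re}(q)>0\}$, $\mathbb S=\{q\in\mathbb H:q^2=-1\}$, and $\mathbb C_I=\mathbb R\oplus I\mathbb R$ for $I\in\mathbb S$. A function $f$ on a domain $\Omega\subseteq\mathbb H$ is slice regular if for every $I\in\mathbb S$ its restriction $f_I$ to $\Omega\cap\mathbb C_I$ has continuous partial derivatives and satisfies $\frac12\left(\frac{\partial}{\partial x}+I\frac{\partial}{\partial y}\right)f_I(x+yI)=0$. For a slice regular $f:\mathbb H^+\to\mathbb H^+$, $f'(\infty)$ denotes the quantity $\inf\left\{\frac{\mathrm{Re}f(q)}{\mathrm{Re}(q)}:q\in\mathbb H^+\right\}$. *)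

theory Defs
  imports "HOL-Analysis.Analysis"
begin

datatype quat = Quat (qre: real) (qim1: real) (qim2: real) (qim3: real)

lemma quat_eq_iff:
  "p = q \<longleftrightarrow> qre p = qre q \<and> qim1 p = qim1 q \<and> qim2 p = qim2 q \<and> qim3 p = qim3 q"
  by (cases p; cases q) simp

instantiation quat :: ab_group_add
begin

definition "0 = Quat 0 0 0 0"
definition "p + q = Quat (qre p + qre q) (qim1 p + qim1 q) (qim2 p + qim2 q) (qim3 p + qim3 q)"
definition "- p = Quat (- qre p) (- qim1 p) (- qim2 p) (- qim3 p)"
definition "p - q = Quat (qre p - qre q) (qim1 p - qim1 q) (qim2 p - qim2 q) (qim3 p - qim3 q)"

instance
  by standard
    (simp_all add: quat_eq_iff zero_quat_def plus_quat_def uminus_quat_def minus_quat_def)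

end

lemma quat_zero_sel [simp]:
  "qre 0 = 0" "qim1 0 = 0" "qim2 0 = 0" "qim3 0 = 0"
  by (simp_all add: zero_quat_def)

lemma quat_add_sel [simp]:
  "qre (p + q) = qre p + qre q" "qim1 (p + q) = qim1 p + qim1 q"
  "qim2 (p + q) = qim2 p + qim2 q" "qim3 (p + q) = qim3 p + qim3 q"
  by (simp_all add: plus_quat_def)

lemma quat_uminus_sel [simp]:
  "qre (- p) = - qre p" "qim1 (- p) = - qim1 p" "qim2 (- p) = - qim2 p" "qim3 (- p) = - qim3 p"
  by (simp_all add: uminus_quat_def)

lemma quat_diff_sel [simp]:
  "qre (p - q) = qre p - qre q" "qim1 (p - q) = qim1 p - qim1 q"
  "qim2 (p - q) = qim2 p - qim2 q" "qim3 (p - q) = qim3 p - qim3 q"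
  by (simp_all add: minus_quat_def)

instantiation quat :: division_ring
begin

definition "1 = Quat 1 0 0 0"

definition "p * q = Quat
  (qre p * qre q - qim1 p * qim1 q - qim2 p * qim2 q - qim3 p * qim3 q)
  (qre p * qim1 q + qim1 p * qre q + qim2 p * qim3 q - qim3 p * qim2 q)
  (qre p * qim2 q - qim1 p * qim3 q + qim2 p * qre q + qim3 p * qim1 q)
  (qre p * qim3 q + qim1 p * qim2 q - qim2 p * qim1 q + qim3 p * qre q)"

definition "inverse q =
  (let n = (qre q)\<^sup>2 + (qim1 q)\<^sup>2 + (qim2 q)\<^sup>2 + (qim3 q)\<^sup>2
   in Quat (qre q / n) (- qim1 q / n) (- qim2 q / n) (- qim3 q / n))"

definition "(p :: quat) div q = p * inverse q"

instance
proof
  fix p q r :: quat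
  show "p * q * r = p * (q * r)" "(p + q) * r = p * r + q * r" "p * (q + r) = p * q + p * r"
    by (simp_all add: quat_eq_iff times_quat_def algebra_simps)
  show "1 * p = p" "p * 1 = p" "(0 :: quat) \<noteq> 1"
    by (simp_all add: quat_eq_iff times_quat_def one_quat_def)
  show "inverse (0 :: quat) = 0"
    by (simp add: quat_eq_iff inverse_quat_def)
  show "p div q = p * inverse q"
    by (rule divide_quat_def)
  assume "p \<noteq> 0"
  define n where "n = (qre p)\<^sup>2 + (qim1 p)\<^sup>2 + (qim2 p)\<^sup>2 + (qim3 p)\<^sup>2"
  have "n \<noteq> 0"
    using \<open>p \<noteq> 0\<close> by (auto simp: n_def quat_eq_iff add_nonneg_eq_0_iff)
  moreover have "inverse p = Quat (qre p / n) (- qim1 p / n) (- qim2 p / n) (- qim3 p / n)"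
    by (simp add: inverse_quat_def n_def Let_def)
  ultimately show "inverse p * p = 1" "p * inverse p = 1"
    unfolding quat_eq_iff times_quat_def one_quat_def
    by (simp_all add: add_divide_distrib [symmetric] diff_divide_distrib [symmetric]
        n_def power2_eq_square algebra_simps)
qed

end

lemma quat_one_sel [simp]:
  "qre 1 = 1" "qim1 1 = 0" "qim2 1 = 0" "qim3 1 = 0"
  by (simp_all add: one_quat_def)

lemma quat_mult_sel [simp]:
  "qre (p * q) = qre p * qre q - qim1 p * qim1 q - qim2 p * qim2 q - qim3 p * qim3 q"
  "qim1 (p * q) = qre p * qim1 q + qim1 p * qre q + qim2 p * qim3 q - qim3 p * qim2 q"
  "qim2 (p * q) = qre p * qim2 q - qim1 p * qim3 q + qim2 p * qre q + qim3 p * qim1 q"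
  "qim3 (p * q) = qre p * qim3 q + qim1 p * qim2 q - qim2 p * qim1 q + qim3 p * qre q"
  by (simp_all add: times_quat_def)

instantiation quat :: real_algebra_1
begin

definition "r *\<^sub>R q = Quat (r * qre q) (r * qim1 q) (r * qim2 q) (r * qim3 q)"

instance
  by standard (simp_all add: quat_eq_iff scaleR_quat_def algebra_simps)

end

lemma quat_scaleR_sel [simp]:
  "qre (r *\<^sub>R q) = r * qre q" "qim1 (r *\<^sub>R q) = r * qim1 q"
  "qim2 (r *\<^sub>R q) = r * qim2 q" "qim3 (r *\<^sub>R q) = r * qim3 q"
  by (simp_all add: scaleR_quat_def)

lemma quat_of_real_sel [simp]:
  "qre (of_real r) = r" "qim1 (of_real r) = 0" "qim2 (of_real r) = 0" "qim3 (of_real r) = 0"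
  by (simp_all add: of_real_def)

instantiation quat :: real_inner
begin

definition "inner p q = qre p * qre q + qim1 p * qim1 q + qim2 p * qim2 q + qim3 p * qim3 q"
definition "norm q = sqrt ((qre q)\<^sup>2 + (qim1 q)\<^sup>2 + (qim2 q)\<^sup>2 + (qim3 q)\<^sup>2)"
definition "sgn (q :: quat) = q /\<^sub>R norm q"
definition "dist (p :: quat) q = norm (p - q)"
definition "(uniformity :: (quat \<times> quat) filter) =
  (INF e\<in>{0 <..}. principal {(p, q). dist p q < e})"
definition "open (U :: quat set) \<longleftrightarrow> (\<forall>p\<in>U. eventually (\<lambda>(p', q). p' = p \<longrightarrow> q \<in> U) uniformity)"

instance
proof
  fix p q r :: quat and a :: real and U :: "quat set"
  show "dist p q = norm (p - q)" "sgn p = p /\<^sub>R norm p"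
    by (rule dist_quat_def sgn_quat_def)+
  show "(uniformity :: (quat \<times> quat) filter) = (INF e\<in>{0 <..}. principal {(p, q). dist p q < e})"
    by (rule uniformity_quat_def)
  show "open U \<longleftrightarrow> (\<forall>p\<in>U. eventually (\<lambda>(p', q). p' = p \<longrightarrow> q \<in> U) uniformity)"
    by (rule open_quat_def)
  show "inner p q = inner q p" "inner (p + q) r = inner p r + inner q r"
    "inner (a *\<^sub>R p) q = a * inner p q" "0 \<le> inner p p"
    by (simp_all add: inner_quat_def algebra_simps)
  show "inner p p = 0 \<longleftrightarrow> p = 0"
    by (auto simp: inner_quat_def quat_eq_iff add_nonneg_eq_0_iff)
  show "norm p = sqrt (inner p p)"
    by (simp add: inner_quat_def norm_quat_def power2_eq_square)
qed

end

instance quat :: real_normed_div_algebra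
proof
  fix p q :: quat
  show "norm (p * q) = norm p * norm q"
    unfolding norm_quat_def real_sqrt_mult [symmetric]
    by (rule arg_cong [where f = sqrt]) (simp add: power2_eq_square algebra_simps)
qed

definition right_half_space :: "quat set" (\<open>\<H>\<^sup>+\<close>)
  where "\<H>\<^sup>+ = {q. qre q > 0}"

definition imaginary_units :: "quat set" (\<open>\<S>\<close>)
  where "\<S> = {q. q\<^sup>2 = -1}"

definition slice_point :: "quat \<Rightarrow> real \<Rightarrow> real \<Rightarrow> quat"
  where "slice_point I x y = of_real x + of_real y * I"

definition slice_dx :: "quat \<Rightarrow> (quat \<Rightarrow> quat) \<Rightarrow> real \<Rightarrow> real \<Rightarrow> quat"
  where "slice_dx I f x y = vector_derivative (\<lambda>t. f (slice_point I t y)) (at x)"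

definition slice_dy :: "quat \<Rightarrow> (quat \<Rightarrow> quat) \<Rightarrow> real \<Rightarrow> real \<Rightarrow> quat"
  where "slice_dy I f x y = vector_derivative (\<lambda>t. f (slice_point I x t)) (at y)"

text \<open>
  The slice \<open>\<Omega> \<inter> \<complex>\<^sub>I\<close> is parametrised by the pairs \<open>(x, y)\<close> with \<open>x + y I \<in> \<Omega>\<close>.
  The predicate is meant for open \<open>\<Omega>\<close>: then the derivatives at points of \<open>\<Omega>\<close> depend only
  on the values of \<open>f\<close> on \<open>\<Omega>\<close>.  Since \<open>vector_derivative\<close> is arbitrary where no derivative
  exists, existence of the partial derivatives is required separately.
\<close>

definition slice_regular_on :: "quat set \<Rightarrow> (quat \<Rightarrow> quat) \<Rightarrow> bool"
  where "slice_regular_on \<Omega> f \<longleftrightarrow> (\<forall>I\<in>\<S>.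
    (\<forall>x y. slice_point I x y \<in> \<Omega> \<longrightarrow>
      (\<lambda>t. f (slice_point I t y)) differentiable (at x) \<and>
      (\<lambda>t. f (slice_point I x t)) differentiable (at y)) \<and>
    continuous_on {(x, y). slice_point I x y \<in> \<Omega>} (\<lambda>(x, y). slice_dx I f x y) \<and>
    continuous_on {(x, y). slice_point I x y \<in> \<Omega>} (\<lambda>(x, y). slice_dy I f x y) \<and>
    (\<forall>x y. slice_point I x y \<in> \<Omega> \<longrightarrow>
      (1 / 2) *\<^sub>R (slice_dx I f x y + I * slice_dy I f x y) = 0))"

text \<open>
  For \<open>f\<close> mapping \<open>\<H>\<^sup>+\<close> to itself the set of quotients is nonempty and bounded below by \<open>0\<close>,
  so the real infimum is the intended one.
\<close>

definition deriv_at_infinity :: "(quat \<Rightarrow> quat) \<Rightarrow> real"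
  where "deriv_at_infinity f = Inf {qre (f q) / qre q | q. q \<in> \<H>\<^sup>+}"

end

theory Submission
  imports Defs "HOL-Complex_Analysis.Conformal_Mappings"
begin

text \<open>
  The inequality only needs the quotient \<open>qre (f q) / qre q\<close> at the fixed point, where it is \<open>1\<close>.
  If the infimum equals \<open>1\<close>, then \<open>g q = f q - q\<close> has \<open>qre (g q) \<ge> 0\<close> on the half-space and
  vanishes at \<open>q\<^sub>0\<close>; the task is to deduce \<open>g = 0\<close>.

  Identify the slice through \<open>K \<in> \<S>\<close> with \<open>\<complex>\<close>. The map \<open>slice_coord K p = qre p + \<i> (p \<bullet> K)\<close> is
  complex linear for left multiplication by the slice, so it turns a slice regular function into an
  ordinary holomorphic one (\<open>slice_regular_imp_holomorphic\<close>). Right multiplication by a constant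
  \<open>a\<close> preserves slice regularity, and letting \<open>a\<close> vary recovers every component of the function.

  Apply the minimum principle for real parts (\<open>Re_nonneg_zero_imp_constant\<close>) to the coordinate of
  \<open>g\<close>. On the slice through \<open>q\<^sub>0\<close> it shows that \<open>qre g\<close> vanishes, in particular at the real point
  \<open>1\<close>. All slices share this point, so the principle applies to each of them: for every \<open>K\<close>, the
  coordinate of \<open>g\<close> along \<open>K\<close> is constant on the slice of \<open>K\<close>. On the positive real axis all these
  coordinates are available at once, so \<open>g\<close> is constant there. The identity theorem spreads this
  constant over every slice, and its value at \<open>q\<^sub>0\<close> is \<open>0\<close>.
\<close>

section \<open>Slices of the quaternions\<close>

lemma imaginary_unit_iff:
  "K \<in> \<S> \<longleftrightarrow> qre K = 0 \<and> (qim1 K)\<^sup>2 + (qim2 K)\<^sup>2 + (qim3 K)\<^sup>2 = 1"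
proof
  assume "K \<in> \<S>"
  then have sq: "(qre K)\<^sup>2 - (qim1 K)\<^sup>2 - (qim2 K)\<^sup>2 - (qim3 K)\<^sup>2 = -1"
    and im: "qre K * qim1 K = 0" "qre K * qim2 K = 0" "qre K * qim3 K = 0"
    by (simp_all add: imaginary_units_def power2_eq_square quat_eq_iff algebra_simps)
  have "qre K = 0"
  proof (rule ccontr)
    assume "qre K \<noteq> 0"
    with im have "qim1 K = 0" "qim2 K = 0" "qim3 K = 0"
      by simp_all
    with sq have "(qre K)\<^sup>2 = -1"
      by simp
    then show False
      by (metis not_one_le_zero zero_le_power2 neg_0_le_iff_le)
  qed
  with sq show "qre K = 0 \<and> (qim1 K)\<^sup>2 + (qim2 K)\<^sup>2 + (qim3 K)\<^sup>2 = 1"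
    by simp
next
  assume "qre K = 0 \<and> (qim1 K)\<^sup>2 + (qim2 K)\<^sup>2 + (qim3 K)\<^sup>2 = 1"
  then show "K \<in> \<S>"
    by (simp add: imaginary_units_def power2_eq_square quat_eq_iff algebra_simps)
qed

lemma slice_point_in_half_space_iff:
  assumes "K \<in> \<S>"
  shows "slice_point K x y \<in> \<H>\<^sup>+ \<longleftrightarrow> x > 0"
  using assms by (simp add: slice_point_def right_half_space_def imaginary_unit_iff)

lemma slice_point_real [simp]: "slice_point K x 0 = of_real x"
  by (simp add: slice_point_def)

lemma exists_slice_point:
  obtains K y where "K \<in> \<S>" "q = slice_point K (qre q) y"
proof (cases "(qim1 q)\<^sup>2 + (qim2 q)\<^sup>2 + (qim3 q)\<^sup>2 = 0")
  case True
  then have "qim1 q = 0 \<and> qim2 q = 0 \<and> qim3 q = 0"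
    by (simp add: add_nonneg_eq_0_iff)
  then have "q = slice_point (Quat 0 1 0 0) (qre q) 0"
    by (simp add: quat_eq_iff)
  then show ?thesis
    by (intro that[of "Quat 0 1 0 0" 0]) (simp_all add: imaginary_unit_iff)
next
  case False
  define n where "n = sqrt ((qim1 q)\<^sup>2 + (qim2 q)\<^sup>2 + (qim3 q)\<^sup>2)"
  have n2: "n\<^sup>2 = (qim1 q)\<^sup>2 + (qim2 q)\<^sup>2 + (qim3 q)\<^sup>2"
    by (simp add: n_def)
  with False have "n \<noteq> 0"
    by auto
  let ?K = "Quat 0 (qim1 q / n) (qim2 q / n) (qim3 q / n)"
  have "?K \<in> \<S>"
    using \<open>n \<noteq> 0\<close>
    by (simp add: imaginary_unit_iff power_divide n2[symmetric] flip: add_divide_distrib)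
  moreover have "q = slice_point ?K (qre q) n"
    using \<open>n \<noteq> 0\<close> by (simp add: slice_point_def quat_eq_iff)
  ultimately show ?thesis
    by (rule that)
qed

definition slice_coord :: "quat \<Rightarrow> quat \<Rightarrow> complex"
  where "slice_coord K p = Complex (qre p) (p \<bullet> K)"

lemma Re_slice_coord [simp]: "Re (slice_coord K p) = qre p"
  by (simp add: slice_coord_def)

lemma bounded_linear_slice_coord: "bounded_linear (slice_coord K)"
proof -
  have "slice_coord K = (\<lambda>p. of_real (p \<bullet> 1) + \<i> * of_real (p \<bullet> K))"
    by (rule ext) (simp add: slice_coord_def complex_eq_iff inner_quat_def)
  then show ?thesis
    by (simp only:)
      (intro bounded_linear_add bounded_linear_compose[OF bounded_linear_of_real]
        bounded_linear_compose[OF bounded_linear_mult_right] bounded_linear_inner_left)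
qed

lemma slice_coord_add: "slice_coord K (p + q) = slice_coord K p + slice_coord K q"
  by (rule linear_add[OF bounded_linear.linear[OF bounded_linear_slice_coord]])

lemma slice_coord_diff: "slice_coord K (p - q) = slice_coord K p - slice_coord K q"
  by (rule linear_diff[OF bounded_linear.linear[OF bounded_linear_slice_coord]])

lemma slice_coord_scaleR: "slice_coord K (r *\<^sub>R p) = r *\<^sub>R slice_coord K p"
  by (rule linear_cmul[OF bounded_linear.linear[OF bounded_linear_slice_coord]])

lemma slice_coord_unit_mult:
  assumes "K \<in> \<S>"
  shows "slice_coord K (K * p) = \<i> * slice_coord K p"
proof -
  have re: "qre K = 0" and nrm: "(qim1 K)\<^sup>2 + (qim2 K)\<^sup>2 + (qim3 K)\<^sup>2 = 1"
    using assms by (simp_all add: imaginary_unit_iff)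
  have "(K * p) \<bullet> K = qre p * ((qim1 K)\<^sup>2 + (qim2 K)\<^sup>2 + (qim3 K)\<^sup>2)"
    by (simp add: inner_quat_def re power2_eq_square algebra_simps)
  then have "(K * p) \<bullet> K = qre p"
    by (simp only: nrm mult_1_right)
  moreover have "qre (K * p) = - (p \<bullet> K)"
    by (simp add: inner_quat_def re algebra_simps)
  ultimately show ?thesis
    by (simp add: complex_eq_iff slice_coord_def del: quat_mult_sel)
qed

lemma slice_coord_slice_point_mult:
  assumes "K \<in> \<S>"
  shows "slice_coord K (slice_point K (Re z) (Im z) * p) = z * slice_coord K p"
proof -
  have "slice_point K (Re z) (Im z) * p = Re z *\<^sub>R p + Im z *\<^sub>R (K * p)"
    by (simp add: slice_point_def algebra_simps of_real_def)
  then have "slice_coord K (slice_point K (Re z) (Im z) * p) =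
      Re z *\<^sub>R slice_coord K p + Im z *\<^sub>R (\<i> * slice_coord K p)"
    by (simp only: slice_coord_add slice_coord_scaleR slice_coord_unit_mult[OF assms])
  also have "\<dots> = (of_real (Re z) + \<i> * of_real (Im z)) * slice_coord K p"
    by (simp add: scaleR_conv_of_real algebra_simps)
  finally show ?thesis
    by (simp flip: complex_eq)
qed

text \<open>The right factor lets the real part alone separate points: \<open>inverse p\<close> detects \<open>p \<noteq> 0\<close>.\<close>

lemma quat_eqI_slice_coord:
  assumes "\<And>a. slice_coord K (p * a) = slice_coord K (q * a)"
  shows "p = q"
proof (rule ccontr)
  assume "p \<noteq> q"
  have "slice_coord K ((p - q) * inverse (p - q)) = 0"
    by (simp only: left_diff_distrib[of p q] slice_coord_diff assms) simp
  then have "Re (slice_coord K 1) = 0"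
    using \<open>p \<noteq> q\<close> by simp
  then show False
    by simp
qed

section \<open>Slice regular functions as holomorphic functions\<close>

text \<open>
  The partial derivatives are continuous along the slice, hence the restriction to the slice is
  totally differentiable.
\<close>

lemma slice_regular_has_derivative:
  assumes reg: "slice_regular_on \<H>\<^sup>+ f" and K: "K \<in> \<S>" and x: "x > 0"
  shows "((\<lambda>(x, y). f (slice_point K x y)) has_derivative
      (\<lambda>(s, t). s *\<^sub>R slice_dx K f x y + t *\<^sub>R slice_dy K f x y)) (at (x, y))"
proof -
  have dom: "{(x, y). slice_point K x y \<in> \<H>\<^sup>+} = {0<..} \<times> UNIV"
    by (auto simp: slice_point_in_half_space_iff[OF K])
  have diff: "(\<lambda>t. f (slice_point K t y)) differentiable (at x)"
      "(\<lambda>t. f (slice_point K x t)) differentiable (at y)" if "x > 0" for x y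
    using reg K that by (auto simp: slice_regular_on_def slice_point_in_half_space_iff)
  have dx: "((\<lambda>t. f (slice_point K t y)) has_derivative (\<lambda>s. s *\<^sub>R slice_dx K f x y))
      (at x within {0<..})"
    using diff(1)[OF x, of y]
    by (simp add: vector_derivative_works slice_dx_def has_vector_derivative_def
        has_derivative_at_withinI)
  have dy: "((\<lambda>t. f (slice_point K x t)) has_derivative
      blinfun_apply (blinfun_scaleR_left (slice_dy K f x y))) (at y within UNIV)"
    if "x \<in> {0<..}" for x y
    using diff(2)[of x y] that
    by (simp add: vector_derivative_works slice_dy_def has_vector_derivative_def)
  have "continuous_on ({0<..} \<times> UNIV) (\<lambda>(x, y). slice_dy K f x y)"
    using reg K by (auto simp: slice_regular_on_def simp flip: dom)
  then have "((\<lambda>(x, y). slice_dy K f x y) \<longlongrightarrow> slice_dy K f x y)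
      (at (x, y) within {0<..} \<times> UNIV)"
    using x by (auto simp: continuous_on_def)
  then have cont: "continuous (at (x, y) within {0<..} \<times> UNIV)
      (\<lambda>(x, y). blinfun_scaleR_left (slice_dy K f x y))"
    unfolding continuous_within case_prod_unfold fst_conv snd_conv
    by (rule bounded_linear.tendsto[OF bounded_linear_blinfun_scaleR_left])
  have "((\<lambda>(x, y). f (slice_point K x y)) has_derivative
      (\<lambda>(s, t). s *\<^sub>R slice_dx K f x y + blinfun_scaleR_left (slice_dy K f x y) t))
      (at (x, y) within {0<..} \<times> UNIV)"
    by (rule has_derivative_partialsI[where f = "\<lambda>x y. f (slice_point K x y)", OF dx _ cont])
      (use dy in auto)
  moreover have "at (x, y) within {0<..} \<times> UNIV = at (x, y)"
    using x by (intro at_within_open open_Times) auto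
  ultimately show ?thesis
    by simp
qed

text \<open>
  The equation of slice regularity says that the \<open>y\<close>-derivative is \<open>K\<close> times the
  \<open>x\<close>-derivative, which \<open>slice_coord K\<close> turns into the Cauchy-Riemann equations. The factor
  \<open>a\<close> stands on the right and therefore commutes with the left multiplication by \<open>K\<close>.
\<close>

lemma slice_regular_imp_holomorphic:
  assumes reg: "slice_regular_on \<H>\<^sup>+ f" and K: "K \<in> \<S>"
  shows "(\<lambda>z. slice_coord K (f (slice_point K (Re z) (Im z)) * a)) holomorphic_on {z. Re z > 0}"
proof (rule holomorphic_onI)
  fix z :: complex
  assume "z \<in> {z. Re z > 0}"
  then have x: "Re z > 0"
    by simp
  define D where "D = slice_dx K f (Re z) (Im z)"
  define E where "E = slice_dy K f (Re z) (Im z)"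
  have "D + K * E = 0"
    using reg K x by (auto simp: slice_regular_on_def slice_point_in_half_space_iff D_def E_def)
  then have "K * (D + K * E) = 0"
    by simp
  moreover have "K * (K * E) = - E"
    using K by (simp add: imaginary_units_def power2_eq_square flip: mult.assoc)
  ultimately have E: "E = K * D"
    by (simp add: distrib_left)
  have "((\<lambda>z. (Re z, Im z)) has_derivative (\<lambda>w. (Re w, Im w))) (at z)"
    by (intro derivative_intros)
  moreover note slice_regular_has_derivative[OF reg K x, of "Im z"]
  ultimately have "((\<lambda>z. f (slice_point K (Re z) (Im z))) has_derivative
      (\<lambda>w. Re w *\<^sub>R D + Im w *\<^sub>R E)) (at z)"
    unfolding D_def E_def by (auto dest: has_derivative_compose)
  then have "((\<lambda>z. slice_coord K (f (slice_point K (Re z) (Im z)) * a)) has_derivative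
      (\<lambda>w. slice_coord K ((Re w *\<^sub>R D + Im w *\<^sub>R E) * a))) (at z)"
    by (intro bounded_linear.has_derivative[OF bounded_linear_slice_coord]
        bounded_linear.has_derivative[OF bounded_linear_mult_left])
  moreover have "slice_coord K ((Re w *\<^sub>R D + Im w *\<^sub>R E) * a) = slice_coord K (D * a) * w" for w
  proof -
    have "(Re w *\<^sub>R D + Im w *\<^sub>R E) * a = slice_point K (Re w) (Im w) * (D * a)"
      by (simp add: E slice_point_def of_real_def algebra_simps)
    then show ?thesis
      by (simp add: slice_coord_slice_point_mult[OF K])
  qed
  ultimately show "(\<lambda>z. slice_coord K (f (slice_point K (Re z) (Im z)) * a))
      field_differentiable at z within {z. Re z > 0}"
    by (auto simp: field_differentiable_def has_field_derivative_def
        intro!: has_derivative_at_withinI)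
qed

section \<open>Holomorphic functions on the right half-plane\<close>

text \<open>
  By the open mapping theorem, a nonconstant holomorphic function reaches values to the left of
  any of its values.
\<close>

lemma Re_nonneg_zero_imp_constant:
  assumes hol: "h holomorphic_on S" and S: "open S" "connected S"
    and nonneg: "\<And>z. z \<in> S \<Longrightarrow> Re (h z) \<ge> 0" and z0: "z0 \<in> S" "Re (h z0) = 0"
  shows "h constant_on S"
proof (rule ccontr)
  assume "\<not> h constant_on S"
  with open_mapping_thm[OF hol S S(1) order_refl] have "open (h ` S)" .
  from openE[OF this imageI[OF z0(1)]]
  obtain e where e: "e > 0" "ball (h z0) e \<subseteq> h ` S" .
  have "norm (of_real (e / 2) :: complex) < e"
    unfolding norm_of_real using e(1) by simp
  then have "h z0 - of_real (e / 2) \<in> ball (h z0) e"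
    unfolding mem_ball dist_norm by simp
  from subsetD[OF e(2) this] obtain z where z: "z \<in> S" "h z0 - of_real (e / 2) = h z"
    by (rule imageE) (metis that)
  have "Re (h z) = - (e / 2)"
    unfolding z(2)[symmetric] using z0(2) by simp
  with nonneg[OF z(1)] e(1) show False
    by simp
qed

lemma open_connected_right_half_plane:
  "open {z. Re z > 0}" "connected {z. Re z > 0}"
  by (rule open_halfspace_Re_gt, rule convex_connected[OF convex_halfspace_Re_gt])

lemma holomorphic_eq_from_positive_reals:
  assumes hol: "g holomorphic_on {z. Re z > 0}" "h holomorphic_on {z. Re z > 0}"
    and eq: "\<And>x. x > 0 \<Longrightarrow> g (of_real x) = h (of_real x)" and z: "Re z > 0"
  shows "g z = h z"
proof -
  have limpt: "(1 :: complex) islimpt of_real ` {0<..}"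
    unfolding islimpt_approachable
  proof (intro allI impI)
    fix e :: real
    assume "e > 0"
    have "dist (of_real (1 + e / 2)) (1 :: complex) = dist (1 + e / 2) 1"
      by (metis dist_of_real of_real_1)
    with \<open>e > 0\<close> have "dist (of_real (1 + e / 2)) (1 :: complex) < e"
      by (simp add: dist_real_def)
    with \<open>e > 0\<close> show "\<exists>x\<in>of_real ` {0<..}. x \<noteq> 1 \<and> dist x (1 :: complex) < e"
      by (intro bexI[of _ "of_real (1 + e / 2)"] conjI) (auto simp del: of_real_add)
  qed
  have "g z - h z = 0"
    by (rule analytic_continuation[where f = "\<lambda>z. g z - h z",
          OF holomorphic_on_diff[OF hol] open_connected_right_half_plane _ _ limpt])
      (use eq z in auto)
  then show ?thesis
    by simp
qed

section \<open>Rigidity\<close>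

text \<open>
  On the slice of \<open>K\<close> the displacement \<open>f q - q\<close> has the holomorphic coordinate \<open>F z - z\<close>, whose
  real part is nonnegative and vanishes at the contact point \<open>x0 + y0 K\<close>. The other two real
  components of the displacement are left undetermined here; they are found by varying \<open>K\<close>.
\<close>

lemma slice_coord_displacement_constant:
  assumes reg: "slice_regular_on \<H>\<^sup>+ f" and K: "K \<in> \<S>"
    and ge: "\<And>q. q \<in> \<H>\<^sup>+ \<Longrightarrow> qre q \<le> qre (f q)"
    and touch: "x0 > 0" "qre (f (slice_point K x0 y0)) = x0"
    and xy: "x > 0" "u > 0"
  shows "slice_coord K (f (slice_point K x y) - slice_point K x y) =
    slice_coord K (f (slice_point K u v) - slice_point K u v)"
proof -
  define h where "h z = slice_coord K
    (f (slice_point K (Re z) (Im z)) - slice_point K (Re z) (Im z))" for z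
  have re: "qre (slice_point K s t) = s" for s t
    using K by (simp add: slice_point_def imaginary_unit_iff)
  have "h = (\<lambda>z. slice_coord K (f (slice_point K (Re z) (Im z)) * 1) - z * slice_coord K 1)"
    by (rule ext) (simp add: h_def slice_coord_diff flip: slice_coord_slice_point_mult[OF K])
  then have "h holomorphic_on {z. Re z > 0}"
    by (simp only:) (intro holomorphic_intros slice_regular_imp_holomorphic[OF reg K])
  moreover have "Re (h z) \<ge> 0" if "Re z > 0" for z
    using ge[of "slice_point K (Re z) (Im z)"] that
    by (simp add: h_def re slice_point_in_half_space_iff[OF K])
  moreover have "Re (h (Complex x0 y0)) = 0"
    by (simp add: h_def re touch)
  ultimately have "h constant_on {z. Re z > 0}"
    using touch(1)
    by (intro Re_nonneg_zero_imp_constant[where ?z0.0 = "Complex x0 y0"]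
        open_connected_right_half_plane) auto
  then have "h (Complex x y) = h (Complex u v)"
    using xy by (auto simp: constant_on_def)
  then show ?thesis
    by (simp add: h_def)
qed

text \<open>
  The positive real axis lies in every slice and is not discrete there, so a slice regular function
  is determined by its values on it. Since \<open>q \<mapsto> (q + c) * a\<close> has an affine coordinate on each
  slice, the comparison takes place between holomorphic functions, for each \<open>a\<close> separately.
\<close>

lemma slice_regular_translation_from_positive_reals:
  assumes reg: "slice_regular_on \<H>\<^sup>+ f"
    and real: "\<And>x. x > 0 \<Longrightarrow> f (of_real x) = of_real x + c"
    and q: "q \<in> \<H>\<^sup>+"
  shows "f q = q + c"
proof -
  obtain K y where K: "K \<in> \<S>" and q_eq: "q = slice_point K (qre q) y"
    by (rule exists_slice_point)
  define z where "z = Complex (qre q) y"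
  have q_z: "q = slice_point K (Re z) (Im z)"
    using q_eq by (simp add: z_def)
  have z: "Re z > 0"
    using q by (simp add: z_def right_half_space_def)
  show ?thesis
  proof (rule quat_eqI_slice_coord)
    fix a
    have aff: "slice_coord K ((slice_point K (Re w) (Im w) + c) * a) =
        w * slice_coord K a + slice_coord K (c * a)" for w
      by (simp add: distrib_right slice_coord_add slice_coord_slice_point_mult[OF K])
    have "slice_coord K (f (slice_point K (Re z) (Im z)) * a) =
        z * slice_coord K a + slice_coord K (c * a)"
    proof (rule holomorphic_eq_from_positive_reals[OF slice_regular_imp_holomorphic[OF reg K] _ _ z])
      show "(\<lambda>w. w * slice_coord K a + slice_coord K (c * a)) holomorphic_on {z. Re z > 0}"
        by (intro holomorphic_intros)
      fix x :: real
      assume "x > 0"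
      then show "slice_coord K (f (slice_point K (Re (of_real x)) (Im (of_real x))) * a) =
          of_real x * slice_coord K a + slice_coord K (c * a)"
        using real[of x] aff[of "of_real x"] by simp
    qed
    then show "slice_coord K (f q * a) = slice_coord K ((q + c) * a)"
      by (simp add: aff q_z)
  qed
qed

text \<open>
  The fixed point gives contact on its own slice only. The constancy obtained there carries the
  contact to the real point \<open>1\<close>, and from there to all slices.
\<close>

lemma slice_regular_eq_id_if_Re_ge:
  assumes reg: "slice_regular_on \<H>\<^sup>+ f"
    and ge: "\<And>q. q \<in> \<H>\<^sup>+ \<Longrightarrow> qre q \<le> qre (f q)"
    and q0: "q0 \<in> \<H>\<^sup>+" "f q0 = q0" and q: "q \<in> \<H>\<^sup>+"
  shows "f q = q"
proof -
  define c where "c = f 1 - 1"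
  obtain K0 y0 where K0: "K0 \<in> \<S>" and q0_eq: "q0 = slice_point K0 (qre q0) y0"
    by (rule exists_slice_point)
  have x0: "qre q0 > 0"
    using q0(1) by (simp add: right_half_space_def)
  have "qre (f (slice_point K0 (qre q0) y0)) = qre q0"
    using q0(2) q0_eq by simp
  from slice_coord_displacement_constant[OF reg K0 ge x0 this zero_less_one x0, of 0 y0]
  have "slice_coord K0 (f 1 - 1) = 0"
    using q0(2) by (simp add: linear_0[OF bounded_linear.linear[OF bounded_linear_slice_coord]]
        flip: q0_eq)
  then have "Re (slice_coord K0 (f 1 - 1)) = 0"
    by simp
  then have one: "qre (f (slice_point K 1 0)) = 1" for K
    by simp
  have coord: "slice_coord K (f (of_real x) - of_real x) = slice_coord K c"
    if "K \<in> \<S>" "x > 0" for K x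
    using slice_coord_displacement_constant[OF reg that(1) ge zero_less_one one that(2) zero_less_one,
        of 0 0] by (simp add: c_def)
  have real: "f (of_real x) = of_real x + c" if x: "x > 0" for x
  proof -
    \<comment> \<open>The slices of the three basis units yield all four real components.\<close>
    have "Quat 0 1 0 0 \<in> \<S>" "Quat 0 0 1 0 \<in> \<S>" "Quat 0 0 0 1 \<in> \<S>"
      by (simp_all add: imaginary_unit_iff)
    from this[THEN coord, OF x] have "f (of_real x) - of_real x = c"
      by (simp add: slice_coord_def inner_quat_def quat_eq_iff)
    then show ?thesis
      by (simp add: algebra_simps)
  qed
  note translation = slice_regular_translation_from_positive_reals[OF reg real]
  from translation[OF _ q0(1)] q0(2) have "c = 0"
    by simp
  with translation[OF _ q] show ?thesis
    by simp
qed

theorem theorem10: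
  fixes f :: "quat \<Rightarrow> quat" and q\<^sub>0 :: quat
  assumes "f \<in> \<H>\<^sup>+ \<rightarrow> \<H>\<^sup>+"
    and "slice_regular_on \<H>\<^sup>+ f"
    and "q\<^sub>0 \<in> \<H>\<^sup>+" and "f q\<^sub>0 = q\<^sub>0"
  shows "deriv_at_infinity f \<le> 1 \<and> (deriv_at_infinity f = 1 \<longleftrightarrow> (\<forall>q\<in>\<H>\<^sup>+. f q = q))"
proof -
  let ?R = "{qre (f q) / qre q | q. q \<in> \<H>\<^sup>+}"
  have pos: "qre q > 0" if "q \<in> \<H>\<^sup>+" for q
    using that by (simp add: right_half_space_def)
  have "0 \<le> qre (f q) / qre q" if "q \<in> \<H>\<^sup>+" for q
    using pos[OF that] pos[OF funcset_mem[OF assms(1) that]] by simp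
  then have "bdd_below ?R"
    by (intro bdd_belowI[of _ 0]) auto
  then have lower: "deriv_at_infinity f \<le> qre (f q) / qre q" if "q \<in> \<H>\<^sup>+" for q
    unfolding deriv_at_infinity_def using that by (intro cInf_lower) auto
  have "deriv_at_infinity f \<le> 1"
    using lower[OF assms(3)] assms(4) pos[OF assms(3)] by simp
  moreover have "\<forall>q\<in>\<H>\<^sup>+. f q = q" if "deriv_at_infinity f = 1"
  proof
    have "qre q \<le> qre (f q)" if "q \<in> \<H>\<^sup>+" for q
      using lower[OF that] pos[OF that] \<open>deriv_at_infinity f = 1\<close> by (simp add: field_simps)
    then show "f q = q" if "q \<in> \<H>\<^sup>+" for q
      using slice_regular_eq_id_if_Re_ge[OF assms(2) _ assms(3,4) that] by blast
  qed
  moreover have "deriv_at_infinity f = 1" if id: "\<forall>q\<in>\<H>\<^sup>+. f q = q"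
  proof -
    have "?R = {1}"
      using assms(3) id by (force dest: pos)
    then show ?thesis
      by (simp add: deriv_at_infinity_def)
  qed
  ultimately show ?thesis
    by blast
qed

end
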